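(* There exists an $(\varepsilon_v,0,\delta,\text{single peaked})$-Arbitrary Outliers vs Random Profile Tester with sample complexity $O\left(\frac{1}{(1-3\varepsilon_v)^2}\ln\frac{1}{\delta}\right)$ for every $0\le\varepsilon_v<1/3$.
   Context: Profiles. Let $\mathcal{A}$ be a finite set of $m$ alternatives and $\mathcal{L}(\mathcal{A})$ the set of linear orders (preferences) over $\mathcal{A}$. A profile is a tuple $(\succ_i)_{i\in[n]}$ of $n$ preferences over $\mathcal{A}$, one per agent, where $[n]=\{1,\dots,n\}$. A profile is single peaked if there is a linear order (societal axis) on $\mathcal{A}$ such that, for every preference $\succ$ in the profile with most preferred alternative $t$, whenever $x$ lies between $t$ and $y$ on the axis (with $x\ne y$), we have $x\succ y$. Sampling model. An oracle, when queried, returns an agent picked uniformly at random with replacement from the set of all $n$ agents. The algorithm may then ask this agent arbitrarily many comparison queries: given two alternatives $x,y$, the agent replies which of the two it prefers. The sample complexity of an algorithm is the total number of comparison queries it makes. Problem. Let $\delta\in(0,1)$. An $(\varepsilon_v,0,\delta,\text{single peaked})$-Arbitrary Outliers vs Random Profile Tester is an algorithm in this model which, given a profile $(\succ_i)_{i\in[n]}$ over $\mathcal{A}$ that is of one of the following two kinds, outputs $1$ if it is of kind (i) and $0$ if it is of kind (ii), with error probability at most $\delta$: (i) there exists $\mathcal{W}\subseteq[n]$ with $|\mathcal{W}|\ge(1-\varepsilon_v)n$ such that the profile $(\succ_i)_{i\in\mathcal{W}}$ is single peaked (the parameter $0$ means that no alternatives are deleted); (ii) the preference $\succ_i$ is distributed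 uniformly at random in $\mathcal{L}(\mathcal{A})$ for every $i\in[n]$. The error probability is taken over the randomness used in generating the instance in (ii) and the randomness used by the algorithm.
   Formalization: The formal theorem adds two conditions: at least 3 alternatives (m ≥ 3), and n at least C·ln(1/δ)/(1−3ε_v)² agents. Without them (e.g. n = 1 or m ≤ 2) every profile is single peaked, so no tester with δ < 1/2 exists. *)

theory Defs
  imports "HOL-Probability.Probability"
begin

(* A preference is a reflexive linear order r on the alternatives, with (x, y) \<in> r read as
   "x is at least as preferred as y". A profile of n agents assigns a preference to each of
   the agents 1, ..., n; its values at other naturals are irrelevant. *)

definition linear_orders :: "'a set \<Rightarrow> 'a rel set" where
  "linear_orders A = {r. linear_order_on A r}"

definition prefers :: "'a rel \<Rightarrow> 'a \<Rightarrow> 'a \<Rightarrow> bool" where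
  "prefers r x y \<longleftrightarrow> x \<noteq> y \<and> (x, y) \<in> r"

definition most_preferred :: "'a set \<Rightarrow> 'a rel \<Rightarrow> 'a \<Rightarrow> bool" where
  "most_preferred A r t \<longleftrightarrow> t \<in> A \<and> (\<forall>z\<in>A. z \<noteq> t \<longrightarrow> prefers r t z)"

definition between :: "'a rel \<Rightarrow> 'a \<Rightarrow> 'a \<Rightarrow> 'a \<Rightarrow> bool" where
  "between ax t x y \<longleftrightarrow> (t, x) \<in> ax \<and> (x, y) \<in> ax \<or> (y, x) \<in> ax \<and> (x, t) \<in> ax"

definition single_peaked :: "'a set \<Rightarrow> nat set \<Rightarrow> (nat \<Rightarrow> 'a rel) \<Rightarrow> bool" where
  "single_peaked A W P \<longleftrightarrow>
     (\<exists>ax. linear_order_on A ax \<and>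
        (\<forall>i\<in>W. \<forall>t x y. most_preferred A (P i) t \<and> between ax t x y \<and> x \<noteq> y
                      \<longrightarrow> prefers (P i) x y))"

(* A randomized adaptive algorithm as a decision tree. "Sample" calls the oracle, which returns
   (the label of) a uniformly random agent; this becomes the agent answering the subsequent
   "Compare" queries, until the next "Sample". "Random p" draws from the algorithm's own
   randomness. The tree fixes no number of agents, so an algorithm is uniform in n. *)

datatype 'a algorithm =
    Output bool
  | Sample "nat \<Rightarrow> 'a algorithm"
  | Compare 'a 'a "bool \<Rightarrow> 'a algorithm"
  | Random "nat pmf" "nat \<Rightarrow> 'a algorithm"

(* The "option" argument of run is the agent sampled last. A comparison made before any agent
   was sampled gets the uninformative answer False (and still counts as a query). *)

primrec answer :: "(nat \<Rightarrow> 'a rel) \<Rightarrow> nat option \<Rightarrow> 'a \<Rightarrow> 'a \<Rightarrow> bool" where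
  "answer P None x y = False"
| "answer P (Some i) x y = prefers (P i) x y"

primrec run :: "'a algorithm \<Rightarrow> nat \<Rightarrow> (nat \<Rightarrow> 'a rel) \<Rightarrow> nat option \<Rightarrow> bool pmf" where
  "run (Output b) n P c = return_pmf b"
| "run (Sample k) n P c = bind_pmf (pmf_of_set {1..n}) (\<lambda>i. run (k i) n P (Some i))"
| "run (Compare x y k) n P c = run (k (answer P c x y)) n P c"
| "run (Random p k) n P c = bind_pmf p (\<lambda>s. run (k s) n P c)"

(* The number of comparison queries in the worst case over profiles and all randomness. *)

primrec sample_complexity :: "'a algorithm \<Rightarrow> enat" where
  "sample_complexity (Output b) = 0"
| "sample_complexity (Sample k) = (SUP i. sample_complexity (k i))"
| "sample_complexity (Compare x y k) = 1 + (SUP b. sample_complexity (k b))"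
| "sample_complexity (Random p k) = (SUP s\<in>set_pmf p. sample_complexity (k s))"

definition is_single_peaked_up_to_outliers ::
    "'a set \<Rightarrow> nat \<Rightarrow> real \<Rightarrow> (nat \<Rightarrow> 'a rel) \<Rightarrow> bool" where
  "is_single_peaked_up_to_outliers A n \<epsilon> P \<longleftrightarrow>
     (\<exists>W. W \<subseteq> {1..n} \<and> real (card W) \<ge> (1 - \<epsilon>) * real n \<and> single_peaked A W P)"

(* Independent, uniformly distributed preferences; the value outside {1..n} is a dummy. *)

definition random_profile :: "'a set \<Rightarrow> nat \<Rightarrow> (nat \<Rightarrow> 'a rel) pmf" where
  "random_profile A n = Pi_pmf {1..n} {} (\<lambda>_. pmf_of_set (linear_orders A))"

(* Output True stands for 1 and False for 0. For card A \<le> 2, or for n too small relative to \<epsilon> and \<delta>,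
   a random profile is itself likely single peaked up to outliers, and no algorithm satisfies both
   conjuncts when \<delta> is small. *)

definition arbitrary_outliers_vs_random_tester ::
    "'a set \<Rightarrow> nat \<Rightarrow> real \<Rightarrow> real \<Rightarrow> 'a algorithm \<Rightarrow> bool" where
  "arbitrary_outliers_vs_random_tester A n \<epsilon> \<delta> T \<longleftrightarrow>
     (\<forall>P. (\<forall>i\<in>{1..n}. P i \<in> linear_orders A) \<and> is_single_peaked_up_to_outliers A n \<epsilon> P
          \<longrightarrow> pmf (run T n P None) False \<le> \<delta>) \<and>
     pmf (bind_pmf (random_profile A n) (\<lambda>P. run T n P None)) True \<le> \<delta>"

end

theory Submission
  imports Defs
begin

text \<open>
  Fix three alternatives. In a single-peaked preference the alternative lying between the other two
  on the axis is never the worst of the three, so in a profile of kind (i) some alternative is worst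
  for at most a fraction \<open>\<epsilon>\<close> of the agents. In a random profile, by symmetry, each of the three is worst
  with probability \<open>1/3\<close>. Two comparisons find the worst alternative of a sampled agent, and the tester
  accepts iff some alternative is worst for less than a fraction \<open>(1/3 + \<epsilon>) / 2\<close> of the samples. As
  agents are sampled with replacement from a profile that is itself random, Hoeffding's inequality is
  used twice in kind (ii): for the profile, and for the samples given the profile. When
  \<open>\<delta> \<ge> 1/2\<close>, where the bound can be smaller than one comparison, the tester flips a coin.
\<close>

section \<open>Counts of independent trials and their tails\<close>

lemma map_pmf_pred_bernoulli:
  "map_pmf Q p = bernoulli_pmf (measure_pmf.prob p {x. Q x})"
proof (rule pmf_eqI)
  fix b
  have "measure_pmf.prob p {x. \<not> Q x} = 1 - measure_pmf.prob p {x. Q x}"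
    using measure_pmf.prob_compl[of "{x. Q x}" p] by (simp add: Compl_eq_Diff_UNIV[symmetric] Collect_neg_eq)
  thus "pmf (map_pmf Q p) b = pmf (bernoulli_pmf (measure_pmf.prob p {x. Q x})) b"
    by (cases b) (simp_all add: pmf_map vimage_def)
qed

lemma map_pmf_replicate_pmf:
  "map_pmf (map f) (replicate_pmf k p) = replicate_pmf k (map_pmf f p)"
proof (induction k)
  case (Suc k)
  thus ?case by (simp add: map_bind_pmf bind_map_pmf flip: Suc.IH)
qed simp

text \<open>This handles the randomness of sampling for a fixed profile. Testing each draw for
  equality with \<open>x\<close> turns the draws into Bernoulli trials, whose number of successes is
  binomial.\<close>

lemma count_list_replicate_pmf:
  "map_pmf (\<lambda>xs. count_list xs x) (replicate_pmf k p) = binomial_pmf k (pmf p x)"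
proof -
  have "pmf p x = measure_pmf.prob p {y. x = y}"
    by (simp add: measure_pmf_single)
  hence "binomial_pmf k (pmf p x) =
      map_pmf (length \<circ> filter id) (replicate_pmf k (map_pmf ((=) x) p))"
    by (simp only: map_pmf_pred_bernoulli) (simp add: binomial_pmf_altdef)
  also have "\<dots> = map_pmf (\<lambda>xs. count_list xs x) (replicate_pmf k p)"
    by (simp add: map_pmf_comp o_def filter_map count_list_eq_length_filter
        flip: map_pmf_replicate_pmf)
  finally show ?thesis ..
qed

text \<open>The counterpart for the randomness of the profile: the trials are now the independent
  coordinates, one per agent.\<close>

lemma count_Pi_pmf:
  assumes "finite I"
  shows "map_pmf (\<lambda>f. card {i \<in> I. Q (f i)}) (Pi_pmf I dflt (\<lambda>_. p)) =
         binomial_pmf (card I) (measure_pmf.prob p {x. Q x})"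
proof -
  have "binomial_pmf (card I) (measure_pmf.prob p {x. Q x}) =
      map_pmf (\<lambda>f. card {i \<in> I. f i}) (Pi_pmf I (Q dflt) (\<lambda>_. map_pmf Q p))"
    by (subst binomial_pmf_altdef'[OF assms refl]) (simp_all only: map_pmf_pred_bernoulli, simp)
  also have "\<dots> = map_pmf (\<lambda>f. card {i \<in> I. Q (f i)}) (Pi_pmf I dflt (\<lambda>_. p))"
    by (subst Pi_pmf_map[OF assms refl]) (simp add: map_pmf_comp)
  finally show ?thesis ..
qed

text \<open>Hoeffding's inequality, with the slack \<open>p + t \<le> s\<close> so that it applies
  when only an upper bound on \<open>p\<close> is known.\<close>

lemma binomial_tail_ge:
  assumes "p \<in> {0..1}" "k > 0" "t \<ge> 0" "p + t \<le> s"
  shows "measure_pmf.prob (binomial_pmf k p) {j. real j \<ge> s * real k} \<le> exp (- 2 * real k * t\<^sup>2)"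
proof -
  have "measure_pmf.prob (binomial_pmf k p) {j. real j \<ge> s * real k}
      \<le> measure_pmf.prob (binomial_pmf k p) {j. real j / real k \<ge> p + t}"
  proof (rule measure_pmf.finite_measure_mono)
    have le: "(p + t) * real k \<le> s * real k" using assms(4) by (intro mult_right_mono) simp_all
    show "{j. real j \<ge> s * real k} \<subseteq> {j. real j / real k \<ge> p + t}"
      using assms(2) order_trans[OF le] by (auto simp: pos_le_divide_eq)
  qed simp
  also have "\<dots> \<le> exp (- 2 * real k * t\<^sup>2)"
    using binomial_distribution.prob_ge'[of p k t] assms by (simp add: binomial_distribution_def)
  finally show ?thesis .
qed

lemma binomial_tail_le:
  assumes "p \<in> {0..1}" "k > 0" "t \<ge> 0" "s \<le> p - t"
  shows "measure_pmf.prob (binomial_pmf k p) {j. real j \<le> s * real k} \<le> exp (- 2 * real k * t\<^sup>2)"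
proof -
  have "measure_pmf.prob (binomial_pmf k p) {j. real j \<le> s * real k}
      \<le> measure_pmf.prob (binomial_pmf k p) {j. real j / real k \<le> p - t}"
  proof (rule measure_pmf.finite_measure_mono)
    have le: "s * real k \<le> (p - t) * real k" using assms(4) by (intro mult_right_mono) simp_all
    show "{j. real j \<le> s * real k} \<subseteq> {j. real j / real k \<le> p - t}"
      using assms(2) order_trans[OF _ le] by (auto simp: pos_divide_le_eq)
  qed simp
  also have "\<dots> \<le> exp (- 2 * real k * t\<^sup>2)"
    using binomial_distribution.prob_le'[of p k t] assms by (simp add: binomial_distribution_def)
  finally show ?thesis .
qed

text \<open>Conditioning on the first stage: inside \<open>B\<close> the probability of outcome
  \<open>b\<close> is bounded by 1, outside by \<open>e\<close>.\<close>

lemma pmf_bind_le: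
  assumes "\<And>x. x \<notin> B \<Longrightarrow> pmf (f x) b \<le> e" and "e \<ge> 0"
  shows "pmf (bind_pmf p f) b \<le> measure_pmf.prob p B + e"
proof -
  have "pmf (bind_pmf p f) b = measure_pmf.expectation p (\<lambda>x. pmf (f x) b)"
    by (rule pmf_bind)
  also have "\<dots> \<le> measure_pmf.expectation p (\<lambda>x. indicator B x + e)"
  proof (rule integral_mono)
    show "integrable (measure_pmf p) (\<lambda>x. pmf (f x) b)"
      by (rule measure_pmf.integrable_const_bound[of _ 1]) (auto simp: pmf_le_1)
    show "integrable (measure_pmf p) (\<lambda>x. indicator B x + e)"
      by (rule measure_pmf.integrable_const_bound[of _ "1 + e"]) (auto simp: assms(2) indicator_def)
    show "pmf (f x) b \<le> indicator B x + e" for x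
      using assms pmf_le_1[of "f x" b] by (auto simp: indicator_def intro: order_trans[of _ 1])
  qed
  also have "\<dots> = measure_pmf.prob p B + e"
    by (subst Bochner_Integration.integral_add)
      (auto intro: measure_pmf.integrable_const_bound[of _ 1] simp: measure_pmf.prob_space)
  finally show ?thesis .
qed

section \<open>The worst of three alternatives and single-peakedness\<close>

lemma linear_ordersD:
  assumes "r \<in> linear_orders A"
  shows linear_orders_prefers_total:
      "x \<in> A \<Longrightarrow> y \<in> A \<Longrightarrow> x \<noteq> y \<Longrightarrow> prefers r x y \<or> prefers r y x"
    and linear_orders_prefers_asym: "prefers r x y \<Longrightarrow> \<not> prefers r y x"
    and linear_orders_prefers_trans: "prefers r x y \<Longrightarrow> prefers r y z \<Longrightarrow> prefers r x z"
proof -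
  have "total_on A r" "antisym r" "trans r"
    using assms by (simp_all add: linear_orders_def order_on_defs)
  thus "x \<in> A \<Longrightarrow> y \<in> A \<Longrightarrow> x \<noteq> y \<Longrightarrow> prefers r x y \<or> prefers r y x"
    and "prefers r x y \<Longrightarrow> \<not> prefers r y x"
    and "prefers r x y \<Longrightarrow> prefers r y z \<Longrightarrow> prefers r x z"
    unfolding prefers_def by (metis total_on_def, metis antisymD, metis antisymD transD)
qed

lemma finite_linear_orders: "finite A \<Longrightarrow> finite (linear_orders A)"
  by (rule finite_subset[of _ "Pow (A \<times> A)"]) (auto simp: linear_orders_def order_on_defs)

lemma linear_orders_nonempty: "linear_orders A \<noteq> {}"
  using well_order_on[of A] by (auto simp: linear_orders_def well_order_on_def)

text \<open>Single-peakedness constrains a preference only through its peak, so a peak has to exist.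
  The induction runs over the nonempty subsets of \<open>A\<close> and compares each new element
  with the best one so far.\<close>

lemma most_preferred_exists:
  assumes "finite A" "A \<noteq> {}" "r \<in> linear_orders A"
  shows "\<exists>t. most_preferred A r t"
proof -
  have "B \<noteq> {} \<Longrightarrow> B \<subseteq> A \<Longrightarrow> \<exists>t. most_preferred B r t" if "finite B" for B
    using that
  proof (induction rule: finite_induct)
    case (insert x F)
    show ?case
    proof (cases "F = {}")
      case True
      thus ?thesis by (auto simp: most_preferred_def)
    next
      case False
      with insert obtain t where t: "most_preferred F r t" by auto
      hence "t \<in> A" "x \<in> A" "t \<noteq> x" using insert by (auto simp: most_preferred_def)
      from linear_orders_prefers_total[OF assms(3) this] show ?thesis
      proof
        assume "prefers r t x"
        thus ?thesis using t by (auto simp: most_preferred_def)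
      next
        assume "prefers r x t"
        hence "most_preferred (insert x F) r x"
          using t linear_orders_prefers_trans[OF assms(3)] by (auto simp: most_preferred_def)
        thus ?thesis ..
      qed
    qed
  qed simp
  thus ?thesis using assms by blast
qed

text \<open>Written as the decision tree of the two comparisons that the tester makes, so that a run
  computes it literally. The symmetric description is \<open>worst_eq_iff\<close>.\<close>

definition worst :: "'a \<Rightarrow> 'a \<Rightarrow> 'a \<Rightarrow> 'a rel \<Rightarrow> 'a" where
  "worst a b c r = (if prefers r a b then if prefers r b c then c else b
                    else if prefers r a c then c else a)"

lemma worst_mem: "worst a b c r \<in> {a, b, c}"
  by (auto simp: worst_def)

lemma worst_eq_iff:
  assumes "r \<in> linear_orders A" "{a, b, c} \<subseteq> A" "distinct [a, b, c]"
  shows "worst a b c r = x \<longleftrightarrow> x \<in> {a, b, c} \<and> (\<forall>y\<in>{a, b, c}. y \<noteq> x \<longrightarrow> prefers r y x)"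
proof -
  note [dest] = linear_orders_prefers_asym[OF assms(1)]
  have trans: "prefers r u w" if "prefers r u v" "prefers r v w" for u v w
    using linear_orders_prefers_trans[OF assms(1)] that by blast
  have "prefers r a b \<or> prefers r b a" "prefers r b c \<or> prefers r c b" "prefers r a c \<or> prefers r c a"
    using linear_orders_prefers_total[OF assms(1)] assms(2,3) by auto
  thus ?thesis
    using assms(3) trans[of a b c] trans[of b a c] trans[of a c b] trans[of c a b] trans[of b c a] trans[of c b a]
    unfolding worst_def by auto
qed

text \<open>The witness is the alternative in the middle on the axis. It lies between the peak and
  one of its two neighbours, hence beats that neighbour. The choice depends on the axis alone and so
  serves all agents of \<open>W\<close> at once.\<close>

lemma single_peaked_middle_not_worst:
  assumes "finite A" "\<forall>i\<in>W. P i \<in> linear_orders A" "single_peaked A W P"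
    and abc: "{a, b, c} \<subseteq> A" "distinct [a, b, c]"
  shows "\<exists>x\<in>{a, b, c}. \<forall>i\<in>W. worst a b c (P i) \<noteq> x"
proof -
  from assms(3) obtain ax where ax: "linear_order_on A ax"
    and sp: "\<And>i t x y. i \<in> W \<Longrightarrow> most_preferred A (P i) t \<Longrightarrow> between ax t x y \<Longrightarrow> x \<noteq> y \<Longrightarrow>
       prefers (P i) x y"
    unfolding single_peaked_def by fast
  have tot: "(x, y) \<in> ax \<or> (y, x) \<in> ax" if "x \<in> A" "y \<in> A" for x y
    using ax that by (cases "x = y") (auto simp: order_on_defs total_on_def dest: refl_onD)
  have "(a, b) \<in> ax \<or> (b, a) \<in> ax" "(b, c) \<in> ax \<or> (c, b) \<in> ax" "(a, c) \<in> ax \<or> (c, a) \<in> ax"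
    using tot abc(1) by auto
  moreover have "a \<noteq> b" "b \<noteq> a" "a \<noteq> c" "c \<noteq> a" "b \<noteq> c" "c \<noteq> b" using abc(2) by auto
  \<comment> \<open>Every orientation of the three pairs, cyclic ones included, has a vertex
    \<open>y\<close> with an incoming and an outgoing edge.\<close>
  ultimately have "\<exists>x\<in>{a, b, c}. \<exists>y\<in>{a, b, c}. \<exists>z\<in>{a, b, c}. x \<noteq> y \<and> z \<noteq> y \<and> (x, y) \<in> ax \<and> (y, z) \<in> ax"
    by (elim disjE) simp_all
  then obtain x y z where mem: "x \<in> {a, b, c}" "y \<in> {a, b, c}" "z \<in> {a, b, c}"
    and dist: "x \<noteq> y" "z \<noteq> y" and axs: "(x, y) \<in> ax" "(y, z) \<in> ax" by blast
  have "worst a b c (P i) \<noteq> y" if i: "i \<in> W" for i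
  proof
    assume "worst a b c (P i) = y"
    moreover have Pi: "P i \<in> linear_orders A" using assms(2) i by blast
    ultimately have "\<forall>u\<in>{a, b, c}. u \<noteq> y \<longrightarrow> prefers (P i) u y"
      using worst_eq_iff[OF Pi abc, of y] by simp
    hence w: "prefers (P i) x y" "prefers (P i) z y"
      using dist mem by blast+
    obtain t where t: "most_preferred A (P i) t"
      using most_preferred_exists[OF assms(1) _ Pi] abc by blast
    have "t \<in> A" "y \<in> A" using t mem abc by (auto simp: most_preferred_def)
    \<comment> \<open>If the peak \<open>t\<close> is on the side of \<open>x\<close>, then
      \<open>y\<close> separates it from \<open>z\<close>; otherwise \<open>y\<close> separates it
      from \<open>x\<close>.\<close>
    from tot[OF this] have "between ax t y z \<or> between ax t y x"
      using axs by (auto simp: between_def)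
    hence "prefers (P i) y z \<or> prefers (P i) y x"
      using sp[OF i t, of y z] sp[OF i t, of y x] dist by auto
    with w linear_orders_prefers_asym[OF Pi] show False by blast
  qed
  thus ?thesis using mem(2) by blast
qed

section \<open>Relabelling alternatives, and the law of the worst one\<close>

lemma inv_image_linear_orders:
  assumes r: "r \<in> linear_orders A" and f: "inj f" "\<And>x. f x \<in> A \<longleftrightarrow> x \<in> A"
  shows "inv_image r f \<in> linear_orders A"
proof -
  have "inv_image r f \<subseteq> A \<times> A" "refl_on A (inv_image r f)" "total_on A (inv_image r f)"
    using r f by (auto simp: linear_orders_def order_on_defs refl_on_def total_on_def inj_eq)
  moreover have "trans (inv_image r f)"
    using r by (simp add: linear_orders_def order_on_defs trans_inv_image)
  moreover have "antisym (inv_image r f)"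
    using r f(1) by (auto simp: linear_orders_def order_on_defs antisym_def dest: injD)
  ultimately show ?thesis by (simp add: linear_orders_def order_on_defs)
qed

text \<open>Swapping \<open>x\<close> and \<open>y\<close> in a preference sends those with worst
  \<open>x\<close> injectively to those with worst \<open>y\<close>. Hence the three classes, which
  partition the linear orders, have equal size.\<close>

lemma prob_worst:
  assumes A: "finite A" and abc: "{a, b, c} \<subseteq> A" "distinct [a, b, c]" and x: "x \<in> {a, b, c}"
  shows "measure_pmf.prob (pmf_of_set (linear_orders A)) {r. worst a b c r = x} = 1 / 3"
proof -
  define E where "E x = {r \<in> linear_orders A. worst a b c r = x}" for x
  have fin: "finite (E x)" for x using finite_linear_orders[OF A] by (simp add: E_def)
  have le: "card (E x) \<le> card (E y)" if "x \<in> {a, b, c}" "y \<in> {a, b, c}" for x y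
  proof (rule card_inj_on_le)
    let ?\<tau> = "Transposition.transpose x y"
    have mem: "?\<tau> u \<in> {a, b, c} \<longleftrightarrow> u \<in> {a, b, c}" "?\<tau> u \<in> A \<longleftrightarrow> u \<in> A" for u
      using that abc by (auto simp: Transposition.transpose_def)
    have pref: "prefers (inv_image r ?\<tau>) u v = prefers r (?\<tau> u) (?\<tau> v)" for r u v
      by (auto simp: prefers_def dest: arg_cong[of _ _ ?\<tau>])
    \<comment> \<open>A transposition is an involution, so the relabelling is its own
      inverse.\<close>
    show "inj_on (\<lambda>r. inv_image r ?\<tau>) (E x)"
      by (rule inj_on_inverseI[of _ "\<lambda>r. inv_image r ?\<tau>"]) (auto simp: inv_image_def)
    have "inv_image r ?\<tau> \<in> E y" if r: "r \<in> E x" for r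
    proof -
      have "inv_image r ?\<tau> \<in> linear_orders A"
        by (rule inv_image_linear_orders) (use r mem(2) in \<open>auto simp: E_def\<close>)
      moreover have "prefers r (?\<tau> u) x" if "u \<in> {a, b, c}" "u \<noteq> y" for u
      proof -
        have "?\<tau> u \<noteq> x" using that by (auto simp: Transposition.transpose_def split: if_splits)
        thus ?thesis using r that mem(1)[of u] worst_eq_iff[OF _ abc, of r x]
          by (auto simp only: E_def mem_Collect_eq)
      qed
      ultimately show ?thesis using \<open>y \<in> {a, b, c}\<close>
        by (simp only: E_def mem_Collect_eq worst_eq_iff[OF _ abc] pref transpose_apply_second) blast
    qed
    thus "(\<lambda>r. inv_image r ?\<tau>) ` E x \<subseteq> E y" by blast
  qed (rule fin)
  have "card (linear_orders A) = card (E a \<union> (E b \<union> E c))"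
    using worst_mem[of a b c] by (intro arg_cong[of _ _ card]) (auto simp: E_def)
  also have "\<dots> = card (E a) + (card (E b) + card (E c))"
    using abc(2) fin by (subst card_Un_disjoint; auto simp: E_def card_Un_disjoint)+
  also have "\<dots> = 3 * card (E x)"
    using le[of x a] le[of a x] le[of x b] le[of b x] le[of x c] le[of c x] x by simp
  finally have "card (linear_orders A) = 3 * card (E x)" .
  moreover have "card (linear_orders A) > 0"
    using finite_linear_orders[OF A] linear_orders_nonempty by (simp add: card_gt_0_iff)
  moreover have "linear_orders A \<inter> {r. worst a b c r = x} = E x" by (auto simp: E_def)
  ultimately show ?thesis
    by (simp add: measure_pmf_of_set finite_linear_orders[OF A] linear_orders_nonempty)
qed

section \<open>The tester, its cost and its output distribution\<close>

primrec worst_tester :: "'a \<Rightarrow> 'a \<Rightarrow> 'a \<Rightarrow> nat \<Rightarrow> ('a list \<Rightarrow> bool) \<Rightarrow> 'a algorithm" where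
  "worst_tester a b c 0 test = Output (test [])"
| "worst_tester a b c (Suc k) test =
    (let continue = (\<lambda>x. worst_tester a b c k (\<lambda>xs. test (x # xs))) in
     Sample (\<lambda>_. Compare a b (\<lambda>ab.
       if ab then Compare b c (\<lambda>bc. continue (if bc then c else b))
       else Compare a c (\<lambda>ac. continue (if ac then c else a)))))"

lemma sample_complexity_worst_tester:
  "sample_complexity (worst_tester a b c k test) \<le> enat (2 * k)"
proof (induction k arbitrary: test)
  case (Suc k)
  have step: "1 + (1 + s) \<le> enat (2 * Suc k)" if "s \<le> enat (2 * k)" for s
    using that by (cases s) (auto simp: one_enat_def)
  have cont: "(SUP b'. sample_complexity (worst_tester a b c k (\<lambda>xs. test (f b' # xs)))) \<le> enat (2 * k)"
    for f :: "bool \<Rightarrow> 'a"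
    by (intro SUP_least Suc)
  show ?case
    unfolding worst_tester.simps Let_def sample_complexity.simps
  proof (intro SUP_least)
    have "(SUP ab. sample_complexity
        (if ab then Compare b c (\<lambda>bc. worst_tester a b c k (\<lambda>xs. test ((if bc then c else b) # xs)))
         else Compare a c (\<lambda>ac. worst_tester a b c k (\<lambda>xs. test ((if ac then c else a) # xs)))))
      \<le> 1 + enat (2 * k)"
    proof (intro SUP_least, goal_cases)
      case (1 ab)
      show ?case
        using add_left_mono[OF cont, of 1] by (cases ab) (simp_all only: if_True if_False sample_complexity.simps)
    qed
    from add_left_mono[OF this, of 1] step[of "enat (2 * k)"]
    show "1 + (SUP ab. sample_complexity
        (if ab then Compare b c (\<lambda>bc. worst_tester a b c k (\<lambda>xs. test ((if bc then c else b) # xs)))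
         else Compare a c (\<lambda>ac. worst_tester a b c k (\<lambda>xs. test ((if ac then c else a) # xs)))))
      \<le> enat (2 * Suc k)" by (meson order_refl order_trans)
  qed
qed (simp add: zero_enat_def)

text \<open>This reduces a run to independent draws from the law of the worst alternative among the
  agents. The results so far are stored by prefixing them inside \<open>test\<close>, and the
  current agent changes with each sample, so the induction generalises both.\<close>

lemma run_worst_tester:
  "run (worst_tester a b c k test) n P cur =
     map_pmf test (replicate_pmf k (map_pmf (\<lambda>i. worst a b c (P i)) (pmf_of_set {1..n})))"
proof (induction k arbitrary: test cur)
  case (Suc k)
  have "run (worst_tester a b c (Suc k) test) n P cur =
     bind_pmf (pmf_of_set {1..n})
       (\<lambda>i. run (worst_tester a b c k (\<lambda>xs. test (worst a b c (P i) # xs))) n P (Some i))"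
    by (simp add: Let_def worst_def if_distrib[of "\<lambda>t. run t _ _ _"] cong: if_cong)
      (auto intro!: bind_pmf_cong simp: worst_def)
  also have "\<dots> = map_pmf test (replicate_pmf (Suc k) (map_pmf (\<lambda>i. worst a b c (P i)) (pmf_of_set {1..n})))"
    by (simp add: Suc.IH map_bind_pmf bind_map_pmf map_pmf_def bind_assoc_pmf bind_return_pmf)
  finally show ?case .
qed simp

definition coin_flip :: "'a algorithm" where
  "coin_flip = Random (pmf_of_set {0, 1}) (\<lambda>s. Output (s = 0))"

lemma sample_complexity_coin_flip: "sample_complexity coin_flip = 0"
  by (simp add: coin_flip_def)

lemma run_coin_flip: "run coin_flip n P cur = bernoulli_pmf (1 / 2)"
proof (rule pmf_eqI)
  show "pmf (run coin_flip n P cur) b = pmf (bernoulli_pmf (1 / 2)) b" for b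
    by (cases b) (simp_all add: coin_flip_def pmf_bind_pmf_of_set)
qed

lemma coin_flip_tester:
  "\<delta> \<ge> 1 / 2 \<Longrightarrow> arbitrary_outliers_vs_random_tester A n \<epsilon> \<delta> coin_flip"
  by (simp add: arbitrary_outliers_vs_random_tester_def run_coin_flip)

section \<open>Error probabilities for the two kinds of profiles\<close>

definition rare_worst :: "'a \<Rightarrow> 'a \<Rightarrow> 'a \<Rightarrow> nat \<Rightarrow> real \<Rightarrow> 'a list \<Rightarrow> bool" where
  "rare_worst a b c k \<theta> xs \<longleftrightarrow> (\<exists>x\<in>{a, b, c}. real (count_list xs x) < \<theta> * real k)"

lemma pmf_worst_agents:
  assumes "n > 0"
  shows "pmf (map_pmf (\<lambda>i. worst a b c (P i)) (pmf_of_set {1..n})) x =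
         real (card {i \<in> {1..n}. worst a b c (P i) = x}) / real n"
proof -
  have "{1..n} \<inter> {i. worst a b c (P i) = x} = {i \<in> {1..n}. worst a b c (P i) = x}" by auto
  thus ?thesis using assms by (simp add: pmf_map vimage_def measure_pmf_of_set)
qed

lemma prob_count_list_replicate_pmf:
  "measure_pmf.prob (replicate_pmf k p) {xs. Q (count_list xs x)} =
   measure_pmf.prob (binomial_pmf k (pmf p x)) {j. Q j}"
  unfolding count_list_replicate_pmf[symmetric] by (simp add: vimage_def)

text \<open>Some \<open>x\<close> is worst only for agents outside \<open>W\<close>, at most a
  fraction \<epsilon> of all. Rejection requires all three counts to reach the threshold, that of
  \<open>x\<close> among them, so a single upper tail bounds the error.\<close>

lemma outlier_profile_error:
  assumes A: "finite A" and abc: "{a, b, c} \<subseteq> A" "distinct [a, b, c]"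
    and P: "\<forall>i\<in>{1..n}. P i \<in> linear_orders A" and sp: "is_single_peaked_up_to_outliers A n \<epsilon> P"
    and pos: "n > 0" "k > 0" and t: "t \<ge> 0" "\<epsilon> + t \<le> \<theta>"
  shows "pmf (run (worst_tester a b c k (rare_worst a b c k \<theta>)) n P None) False \<le> exp (- 2 * real k * t\<^sup>2)"
proof -
  obtain W where W: "W \<subseteq> {1..n}" "real (card W) \<ge> (1 - \<epsilon>) * real n" "single_peaked A W P"
    using sp unfolding is_single_peaked_up_to_outliers_def by blast
  then obtain x where x: "x \<in> {a, b, c}" "\<forall>i\<in>W. worst a b c (P i) \<noteq> x"
    using single_peaked_middle_not_worst[OF A _ W(3) abc] P by blast
  define p where "p = map_pmf (\<lambda>i. worst a b c (P i)) (pmf_of_set {1..n})"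
  have "card {i \<in> {1..n}. worst a b c (P i) = x} \<le> card ({1..n} - W)"
    using x(2) by (intro card_mono) auto
  hence "real (card {i \<in> {1..n}. worst a b c (P i) = x}) \<le> real n - real (card W)"
    using W(1) card_mono[OF _ W(1)] by (simp add: card_Diff_subset finite_subset)
  hence "pmf p x \<le> \<epsilon>"
    using W(2) pos unfolding p_def pmf_worst_agents[OF pos(1)] by (simp add: pos_divide_le_eq algebra_simps)
  have "pmf (run (worst_tester a b c k (rare_worst a b c k \<theta>)) n P None) False
      = measure_pmf.prob (replicate_pmf k p) {xs. \<not> rare_worst a b c k \<theta> xs}"
    by (simp add: run_worst_tester p_def pmf_map vimage_def)
  also have "\<dots> \<le> measure_pmf.prob (replicate_pmf k p) {xs. real (count_list xs x) \<ge> \<theta> * real k}"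
    using x(1) by (intro measure_pmf.finite_measure_mono) (auto simp: rare_worst_def not_less)
  also have "\<dots> \<le> exp (- 2 * real k * t\<^sup>2)"
    unfolding prob_count_list_replicate_pmf[where Q = "\<lambda>j. real j \<ge> \<theta> * real k"]
    using \<open>pmf p x \<le> \<epsilon>\<close> pos t by (intro binomial_tail_ge) (auto simp: pmf_le_1)
  finally show ?thesis .
qed

lemma measure_pmf_UN3_le:
  assumes "\<And>x. x \<in> {a, b, c} \<Longrightarrow> measure_pmf.prob p (B x) \<le> e" and "distinct [a, b, c]"
  shows "measure_pmf.prob p (\<Union>x\<in>{a, b, c}. B x) \<le> 3 * e"
proof -
  have "measure_pmf.prob p (\<Union>x\<in>{a, b, c}. B x) \<le> (\<Sum>x\<in>{a, b, c}. measure_pmf.prob p (B x))"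
    by (rule measure_pmf.finite_measure_subadditive_finite) auto
  also have "\<dots> \<le> (\<Sum>x\<in>{a, b, c}. e)" by (rule sum_mono) (rule assms(1))
  also have "\<dots> = 3 * e" using assms(2) by simp
  finally show ?thesis .
qed

text \<open>Acceptance means that one of the three counts is low, and which one is not known; the
  union bound over the alternatives gives the factor 3.\<close>

lemma balanced_profile_error:
  assumes abc: "distinct [a, b, c]" and pos: "n > 0" "k > 0" and t: "t \<ge> 0" "\<theta> + t \<le> s"
    and bal: "\<And>x. x \<in> {a, b, c} \<Longrightarrow> real (card {i \<in> {1..n}. worst a b c (P i) = x}) \<ge> s * real n"
  shows "pmf (run (worst_tester a b c k (rare_worst a b c k \<theta>)) n P None) True \<le> 3 * exp (- 2 * real k * t\<^sup>2)"
proof -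
  define p where "p = map_pmf (\<lambda>i. worst a b c (P i)) (pmf_of_set {1..n})"
  have "pmf (run (worst_tester a b c k (rare_worst a b c k \<theta>)) n P None) True
      = measure_pmf.prob (replicate_pmf k p) {xs. rare_worst a b c k \<theta> xs}"
    by (simp add: run_worst_tester p_def pmf_map vimage_def)
  also have "\<dots> \<le> measure_pmf.prob (replicate_pmf k p)
      (\<Union>x\<in>{a, b, c}. {xs. real (count_list xs x) \<le> \<theta> * real k})"
    by (intro measure_pmf.finite_measure_mono) (auto simp: rare_worst_def)
  also have "\<dots> \<le> 3 * exp (- 2 * real k * t\<^sup>2)"
  proof (rule measure_pmf_UN3_le[OF _ abc])
    fix x assume "x \<in> {a, b, c}"
    from bal[OF this] have "pmf p x \<ge> s"
      using pos unfolding p_def pmf_worst_agents[OF pos(1)] by (simp add: pos_le_divide_eq)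
    thus "measure_pmf.prob (replicate_pmf k p) {xs. real (count_list xs x) \<le> \<theta> * real k}
        \<le> exp (- 2 * real k * t\<^sup>2)"
      unfolding prob_count_list_replicate_pmf[where Q = "\<lambda>j. real j \<le> \<theta> * real k"]
      using pos t by (intro binomial_tail_le) (auto simp: pmf_le_1)
  qed
  finally show ?thesis .
qed

text \<open>Repeated draws of one agent are correlated once the profile is random, so the profile is
  fixed first. One gap \<open>t\<close>, from \<open>1 / 3\<close> down to \<open>s\<close>, pays
  for the deviation of the profile; the other, from \<open>s\<close> down to \<theta>, for that of
  the samples.\<close>

lemma random_profile_error:
  assumes A: "finite A" and abc: "{a, b, c} \<subseteq> A" "distinct [a, b, c]"
    and pos: "n > 0" "k > 0" and t: "t \<ge> 0" "\<theta> + t \<le> s" "s + t \<le> 1 / 3"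
  shows "pmf (bind_pmf (random_profile A n)
           (\<lambda>P. run (worst_tester a b c k (rare_worst a b c k \<theta>)) n P None)) True
         \<le> 3 * exp (- 2 * real n * t\<^sup>2) + 3 * exp (- 2 * real k * t\<^sup>2)"
proof -
  define bad where "bad x = {P. real (card {i \<in> {1..n}. worst a b c (P i) = x}) \<le> s * real n}" for x
  have "pmf (bind_pmf (random_profile A n)
           (\<lambda>P. run (worst_tester a b c k (rare_worst a b c k \<theta>)) n P None)) True
      \<le> measure_pmf.prob (random_profile A n) (\<Union>x\<in>{a, b, c}. bad x) + 3 * exp (- 2 * real k * t\<^sup>2)"
    by (intro pmf_bind_le balanced_profile_error[OF abc(2) pos t(1,2)]) (auto simp: bad_def)
  also have "measure_pmf.prob (random_profile A n) (\<Union>x\<in>{a, b, c}. bad x) \<le> 3 * exp (- 2 * real n * t\<^sup>2)"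
  proof (rule measure_pmf_UN3_le[OF _ abc(2)])
    fix x assume x: "x \<in> {a, b, c}"
    have "measure_pmf.prob (random_profile A n) (bad x) =
        measure_pmf.prob (map_pmf (\<lambda>P. card {i \<in> {1..n}. worst a b c (P i) = x}) (random_profile A n))
          {j. real j \<le> s * real n}"
      by (simp add: bad_def vimage_def)
    also have "\<dots> = measure_pmf.prob (binomial_pmf n (1 / 3)) {j. real j \<le> s * real n}"
      unfolding random_profile_def by (subst count_Pi_pmf) (simp_all add: prob_worst[OF A abc x])
    also have "\<dots> \<le> exp (- 2 * real n * t\<^sup>2)"
      using pos t by (intro binomial_tail_le) auto
    finally show "measure_pmf.prob (random_profile A n) (bad x) \<le> exp (- 2 * real n * t\<^sup>2)" .
  qed
  finally show ?thesis by simp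
qed

section \<open>Choice of constants and the final bound\<close>

lemma worst_tester_correct:
  assumes A: "finite A" and abc: "{a, b, c} \<subseteq> A" "distinct [a, b, c]"
    and \<epsilon>: "\<epsilon> < 1 / 3" and \<delta>: "0 < \<delta>" "\<delta> < 1 / 2"
    and k: "real k \<ge> 288 * (1 / (1 - 3 * \<epsilon>)\<^sup>2 * ln (1 / \<delta>))"
    and n: "real n \<ge> 288 * (1 / (1 - 3 * \<epsilon>)\<^sup>2 * ln (1 / \<delta>))"
  shows "arbitrary_outliers_vs_random_tester A n \<epsilon> \<delta>
           (worst_tester a b c k (rare_worst a b c k ((1 / 3 + \<epsilon>) / 2)))"
proof -
  \<comment> \<open>The midpoint threshold is at distance \<open>(1 - 3 * \<epsilon>) / 6\<close>
    from both \<epsilon> and \<open>1 / 3\<close>. Half of this is \<open>t\<close>, since kind (ii)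
    has to fit two gaps above the threshold.\<close>
  define t where "t = (1 - 3 * \<epsilon>) / 12"
  have t: "t > 0" using \<epsilon> by (simp add: t_def)
  have L: "ln (1 / \<delta>) > 0" using \<delta> by simp
  have "\<delta> ^ 3 \<le> (1 / 2) ^ 3" using \<delta> by (intro power_mono) auto
  hence "\<delta> ^ 4 \<le> \<delta> / 6" using \<delta> by (simp add: power_numeral_reduce)
  \<comment> \<open>Kind (ii) adds up six tails, three for the profile and three for the samples, so
    each may be at most \<open>\<delta> / 6\<close>.\<close>
  have tail: "m > 0 \<and> exp (- 2 * real m * t\<^sup>2) \<le> \<delta> / 6"
    if m: "real m \<ge> 288 * (1 / (1 - 3 * \<epsilon>)\<^sup>2 * ln (1 / \<delta>))" for m
  proof
    \<comment> \<open>The constant is \<open>2 * 12^2\<close>, with 12 from the denominator of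
      \<open>t\<close>. It makes each tail at most \<open>\<delta> ^ 4\<close>.\<close>
    have "288 * (1 / (1 - 3 * \<epsilon>)\<^sup>2 * ln (1 / \<delta>)) = 2 * ln (1 / \<delta>) / t\<^sup>2"
      using \<epsilon> by (simp add: t_def power_divide field_simps)
    hence m': "2 * ln (1 / \<delta>) / t\<^sup>2 \<le> real m" using m by simp
    moreover have "2 * ln (1 / \<delta>) / t\<^sup>2 > 0" using L t by simp
    ultimately show "m > 0" by linarith
    have "- 2 * real m * t\<^sup>2 \<le> - 4 * ln (1 / \<delta>)"
      using m' t by (simp add: pos_divide_le_eq)
    also have "\<dots> = ln (\<delta> ^ 4)" using \<delta> by (simp add: ln_div ln_realpow)
    finally have "exp (- 2 * real m * t\<^sup>2) \<le> \<delta> ^ 4" using \<delta> by (simp add: ln_ge_iff)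
    also note \<open>\<delta> ^ 4 \<le> \<delta> / 6\<close>
    finally show "exp (- 2 * real m * t\<^sup>2) \<le> \<delta> / 6" .
  qed
  note k = tail[OF k] and n = tail[OF n]
  show ?thesis
    unfolding arbitrary_outliers_vs_random_tester_def
  proof (intro conjI allI impI; (elim conjE)?)
    fix P assume "\<forall>i\<in>{1..n}. P i \<in> linear_orders A" "is_single_peaked_up_to_outliers A n \<epsilon> P"
    hence "pmf (run (worst_tester a b c k (rare_worst a b c k ((1 / 3 + \<epsilon>) / 2))) n P None) False
        \<le> exp (- 2 * real k * t\<^sup>2)"
      by (rule outlier_profile_error[OF A abc]) (use k n t \<epsilon> in \<open>auto simp: t_def field_simps\<close>)
    thus "pmf (run (worst_tester a b c k (rare_worst a b c k ((1 / 3 + \<epsilon>) / 2))) n P None) False \<le> \<delta>"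
      using k \<delta> by linarith
  next
    have "pmf (bind_pmf (random_profile A n)
         (\<lambda>P. run (worst_tester a b c k (rare_worst a b c k ((1 / 3 + \<epsilon>) / 2))) n P None)) True
        \<le> 3 * exp (- 2 * real n * t\<^sup>2) + 3 * exp (- 2 * real k * t\<^sup>2)"
      by (rule random_profile_error[OF A abc, where s = "1 / 3 - t"])
        (use k n t in \<open>auto simp: t_def field_simps\<close>)
    thus "pmf (bind_pmf (random_profile A n)
         (\<lambda>P. run (worst_tester a b c k (rare_worst a b c k ((1 / 3 + \<epsilon>) / 2))) n P None)) True \<le> \<delta>"
      using k n by linarith
  qed
qed

theorem theorem3p4:
  shows "\<exists>C>0. \<forall>(A :: 'a set) (\<epsilon>v :: real) (\<delta> :: real).
     finite A \<and> card A \<ge> 3 \<and> 0 \<le> \<epsilon>v \<and> \<epsilon>v < 1/3 \<and> 0 < \<delta> \<and> \<delta> < 1 \<longrightarrow>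
     (\<exists>T :: 'a algorithm.
        ereal_of_enat (sample_complexity T) \<le> ereal (C * (1 / (1 - 3 * \<epsilon>v)^2 * ln (1 / \<delta>))) \<and>
        (\<forall>n. real n \<ge> C * (1 / (1 - 3 * \<epsilon>v)^2 * ln (1 / \<delta>)) \<longrightarrow>
             arbitrary_outliers_vs_random_tester A n \<epsilon>v \<delta> T))"
proof (rule exI[of _ 580], intro conjI allI impI; (elim conjE)?)
  fix A :: "'a set" and \<epsilon>v \<delta> :: real
  assume A: "finite A" "card A \<ge> 3" and \<epsilon>: "0 \<le> \<epsilon>v" "\<epsilon>v < 1/3" and \<delta>: "0 < \<delta>" "\<delta> < 1"
  define B where "B = 1 / (1 - 3 * \<epsilon>v)^2 * ln (1 / \<delta>)"
  have "B \<ge> 0" using \<delta> by (simp add: B_def)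
  have "\<exists>T :: 'a algorithm. ereal_of_enat (sample_complexity T) \<le> ereal (580 * B) \<and>
        (\<forall>n. real n \<ge> 580 * B \<longrightarrow> arbitrary_outliers_vs_random_tester A n \<epsilon>v \<delta> T)"
  proof (cases "\<delta> \<ge> 1 / 2")
    case True
    show ?thesis
      using \<open>B \<ge> 0\<close> True
      by (intro exI[of _ coin_flip] conjI allI impI coin_flip_tester)
        (simp_all add: sample_complexity_coin_flip)
  next
    case False
    obtain S where "S \<subseteq> A" "card S = 3" using obtain_subset_with_card_n[OF A(2)] by metis
    then obtain a b c where abc: "{a, b, c} \<subseteq> A" "distinct [a, b, c]"
      by (auto simp: card_3_iff)
    define k where "k = nat \<lceil>288 * B\<rceil>"
    define T where "T = worst_tester a b c k (rare_worst a b c k ((1 / 3 + \<epsilon>v) / 2))"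
    have k: "288 * B \<le> real k" "real k \<le> 288 * B + 1"
      using \<open>B \<ge> 0\<close> by (simp_all add: k_def)
    \<comment> \<open>A lower bound on \<open>B\<close> is needed to absorb the rounding in
      \<open>k\<close>; it holds because \<delta> is now below \<open>1 / 2\<close>.\<close>
    have "1 / 2 \<le> ln (2 :: real)" using ln2_ge_two_thirds by simp
    also have "\<dots> \<le> ln (1 / \<delta>)" using False \<delta> by (simp add: field_simps)
    also have "\<dots> \<le> B"
    proof -
      have "(1 - 3 * \<epsilon>v)\<^sup>2 \<le> 1" using \<epsilon> by (intro power_le_one) auto
      hence "1 \<le> 1 / (1 - 3 * \<epsilon>v)\<^sup>2" using \<epsilon> by simp
      from mult_right_mono[OF this, of "ln (1 / \<delta>)"] show ?thesis using \<delta> by (simp add: B_def)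
    qed
    \<comment> \<open>Two comparisons for each of at most \<open>288 * B + 1\<close> samples cost at
      most \<open>576 * B + 2\<close>, and \<open>2 \<le> 4 * B\<close>; hence 580.\<close>
    finally have "real (2 * k) \<le> 580 * B" using k by simp
    moreover have "ereal_of_enat (sample_complexity T) \<le> ereal_of_enat (enat (2 * k))"
      unfolding T_def ereal_of_enat_le_iff by (rule sample_complexity_worst_tester)
    ultimately have "ereal_of_enat (sample_complexity T) \<le> ereal (580 * B)"
      by (simp add: order_trans)
    moreover have "arbitrary_outliers_vs_random_tester A n \<epsilon>v \<delta> T" if "real n \<ge> 580 * B" for n
      unfolding T_def
      by (rule worst_tester_correct[OF A(1) abc])
        (use \<epsilon> \<delta> False k that \<open>B \<ge> 0\<close> in \<open>auto simp: B_def\<close>)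
    ultimately show ?thesis by blast
  qed
  thus "\<exists>T :: 'a algorithm.
        ereal_of_enat (sample_complexity T) \<le> ereal (580 * (1 / (1 - 3 * \<epsilon>v)^2 * ln (1 / \<delta>))) \<and>
        (\<forall>n. real n \<ge> 580 * (1 / (1 - 3 * \<epsilon>v)^2 * ln (1 / \<delta>)) \<longrightarrow>
             arbitrary_outliers_vs_random_tester A n \<epsilon>v \<delta> T)"
    by (simp only: B_def)
qed simp

end
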